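(* Let $X\subset\{0,1\}^{\mathbb{N}}$ be the shift space $X=\overline{\bigcup_{n\ge0}X_n}$ defined in the context. Then there is no ergodic $\sigma$-invariant Borel probability measure on $X$ whose support is $X$ (i.e. which is positive on all nonempty open subsets of $X$).
   Context: $\mathbb{N}=\{1,2,\dots\}$; $\{0,1\}^{\mathbb{N}}$ carries the product topology and $\sigma$ is the shift map, $\sigma(x)_i=x_{i+1}$. A shift space is a closed $\sigma$-invariant subset. For blocks, $u^\infty=uuu\dots$, $0^\alpha$ is the block of $\alpha$ zeros ($0^0$ is the empty block), and $\|u\|_1$ is the number of $1$'s in $u$. A block is a from-$1$-to-$1$ word if it equals $1$ or has the form $1v1$ with $v\in\{0,1\}^*$ (possibly empty). For a shift space $Y\subset\{0,1\}^{\mathbb{N}}$, $\mathcal{G}_m(Y)$ is the set of all from-$1$-to-$1$ words $u$ that occur in some point of $Y$ and satisfy $\|u\|_1\le m$. Construction of $X$: let $X_0=\{0^\infty\}\cup\{0^\alpha10^\infty:\alpha\ge0\}$. Given $X_n$ ($n\ge0$), let $$P_{n+1}=\bigcup_{l=0}^\infty\sigma^l\big(\{(u0^k)^\infty:k\ge2^{2n},\ u\in\mathcal{G}_{2^n}(X_n)\}\big),$$ $$J'_{n+1}=\{0^\alpha u0^\infty:\alpha\ge0,\ u\in\mathcal{G}_{2^n}(X_n)\},$$ $$J''_{n+1}=\{0^\alpha u0^\beta v0^\infty:\alpha\ge0,\ \beta\ge2^{2n},\ u,v\in\mathcal{G}_{2^n}(X_n)\},$$ $J_{n+1}=J'_{n+1}\cup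 J''_{n+1}$, $Y_{n+1}=\overline{P_{n+1}\cup J_{n+1}}$, and $X_{n+1}=X_n\cup Y_{n+1}$. Finally $X=\overline{\bigcup_{n=0}^\infty X_n}$. *)

theory Defs
  imports "HOL-Probability.Probability_Measure" "HOL-Library.Omega_Words_Fun"
begin

text \<open>
  Points of \<open>{0,1}\<^sup>\<nat>\<close> are functions \<open>nat \<Rightarrow> bool\<close>, with \<open>True\<close> for the symbol 1, \<open>False\<close> for the
  symbol 0, and coordinates counted from 0 rather than from 1. The topology is the
  product topology that the library puts on function types (\<open>bool\<close> being discrete). Blocks
  are lists, \<open>u \<frown> x\<close> is the concatenation of a block and a point and \<open>u\<^sup>\<omega>\<close> is the point \<open>uuu\<dots>\<close>.
\<close>

definition shift_map :: "(nat \<Rightarrow> 'a) \<Rightarrow> (nat \<Rightarrow> 'a)"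
  where "shift_map x = (\<lambda>i. x (Suc i))"

definition shift_space :: "(nat \<Rightarrow> bool) set \<Rightarrow> bool"
  where "shift_space S \<longleftrightarrow> closed S \<and> shift_map ` S \<subseteq> S"

definition zeros :: "nat \<Rightarrow> bool list"
  where "zeros n = replicate n False"

definition zero_seq :: "nat \<Rightarrow> bool"
  where "zero_seq = (\<lambda>_. False)"

definition from_1_to_1 :: "bool list \<Rightarrow> bool"
  where "from_1_to_1 u \<longleftrightarrow> u = [True] \<or> (\<exists>v. u = [True] @ v @ [True])"

definition occurs_in :: "'a list \<Rightarrow> (nat \<Rightarrow> 'a) \<Rightarrow> bool"
  where "occurs_in u x \<longleftrightarrow> (\<exists>i. x [i \<rightarrow> i + length u] = u)"

definition from_1_to_1_words :: "nat \<Rightarrow> (nat \<Rightarrow> bool) set \<Rightarrow> bool list set"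
  where "from_1_to_1_words m Y =
    {u. from_1_to_1 u \<and> (\<exists>x\<in>Y. occurs_in u x) \<and> count_list u True \<le> m}"

text \<open>\<open>P_set n Y\<close>, \<open>J'_set n Y\<close>, \<open>J''_set n Y\<close> are \<open>P\<^sub>n\<^sub>+\<^sub>1\<close>, \<open>J'\<^sub>n\<^sub>+\<^sub>1\<close>, \<open>J''\<^sub>n\<^sub>+\<^sub>1\<close> when \<open>Y = X\<^sub>n\<close>.\<close>

definition P_set :: "nat \<Rightarrow> (nat \<Rightarrow> bool) set \<Rightarrow> (nat \<Rightarrow> bool) set"
  where "P_set n Y =
    (\<Union>l. (shift_map ^^ l) `
      {(u @ zeros k)\<^sup>\<omega> | u k. k \<ge> 2 ^ (2 * n) \<and> u \<in> from_1_to_1_words (2 ^ n) Y})"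

definition J'_set :: "nat \<Rightarrow> (nat \<Rightarrow> bool) set \<Rightarrow> (nat \<Rightarrow> bool) set"
  where "J'_set n Y =
    {zeros \<alpha> \<frown> u \<frown> zero_seq | \<alpha> u. u \<in> from_1_to_1_words (2 ^ n) Y}"

definition J''_set :: "nat \<Rightarrow> (nat \<Rightarrow> bool) set \<Rightarrow> (nat \<Rightarrow> bool) set"
  where "J''_set n Y =
    {zeros \<alpha> \<frown> u \<frown> zeros \<beta> \<frown> v \<frown> zero_seq | \<alpha> u \<beta> v.
      \<beta> \<ge> 2 ^ (2 * n) \<and> u \<in> from_1_to_1_words (2 ^ n) Y \<and> v \<in> from_1_to_1_words (2 ^ n) Y}"

primrec X_approx :: "nat \<Rightarrow> (nat \<Rightarrow> bool) set"
  where
    "X_approx 0 = {zero_seq} \<union> {zeros \<alpha> \<frown> [True] \<frown> zero_seq | \<alpha>. True}"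
  | "X_approx (Suc n) = X_approx n \<union>
      closure (P_set n (X_approx n) \<union> (J'_set n (X_approx n) \<union> J''_set n (X_approx n)))"

definition X_shift :: "(nat \<Rightarrow> bool) set"
  where "X_shift = closure (\<Union>n. X_approx n)"

definition borel_measure_on :: "'a::topological_space set \<Rightarrow> 'a measure \<Rightarrow> bool"
  where "borel_measure_on S M \<longleftrightarrow> sets M = sets (restrict_space borel S)"

definition invariant_measure :: "('a \<Rightarrow> 'a) \<Rightarrow> 'a measure \<Rightarrow> bool"
  where "invariant_measure T M \<longleftrightarrow> T \<in> measurable M M \<and> distr M M T = M"

definition ergodic_measure :: "('a \<Rightarrow> 'a) \<Rightarrow> 'a measure \<Rightarrow> bool"
  where "ergodic_measure T M \<longleftrightarrow> prob_space M \<and> invariant_measure T M \<and>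
    (\<forall>A\<in>sets M. T -` A \<inter> space M = A \<longrightarrow> emeasure M A = 0 \<or> emeasure M A = 1)"

definition full_support_on :: "'a::topological_space set \<Rightarrow> 'a measure \<Rightarrow> bool"
  where "full_support_on S M \<longleftrightarrow>
    (\<forall>U. openin (top_of_set S) U \<and> U \<noteq> {} \<longrightarrow> emeasure M U > 0)"

text \<open>
  The set \<open>X_shift\<close> is indeed a shift space, so that \<open>shift_map\<close> acts on it and
  \<open>invariant_measure\<close> is not vacuously false for measures on it.
\<close>

lemma continuous_on_shift_map:
  "continuous_on S (shift_map :: (nat \<Rightarrow> 'a::topological_space) \<Rightarrow> nat \<Rightarrow> 'a)"
  unfolding shift_map_def
  by (intro continuous_on_coordinatewise_then_product
      continuous_on_subset[OF continuous_on_product_coordinates subset_UNIV])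

lemma shift_map_closure:
  fixes A :: "(nat \<Rightarrow> bool) set"
  assumes "shift_map ` A \<subseteq> closure B"
  shows "shift_map ` closure A \<subseteq> closure B"
  using image_closure_subset[OF continuous_on_shift_map closed_closure assms] .

lemma shift_map_Cons: "shift_map ((a # u) \<frown> x) = u \<frown> x"
  by (auto simp: shift_map_def fun_eq_iff conc_def)

lemma shift_map_build: "shift_map (a ## x) = x"
  by (simp add: shift_map_def fun_eq_iff)

lemma shift_map_zero_seq: "shift_map zero_seq = zero_seq"
  by (simp add: shift_map_def zero_seq_def)

lemma closed_zero_seq: "closed {zero_seq}"
proof -
  have "closed {x :: nat \<Rightarrow> bool. x i = False}" for i
    by (rule closed_Collect_eq[OF continuous_on_product_coordinates continuous_on_const])
  then have "closed (\<Inter>i. {x :: nat \<Rightarrow> bool. x i = False})"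
    by (intro closed_INT ballI)
  also have "(\<Inter>i. {x :: nat \<Rightarrow> bool. x i = False}) = {zero_seq}"
    unfolding zero_seq_def by blast
  finally show ?thesis .
qed

lemma zeros_zero_seq: "zeros k \<frown> zero_seq = zero_seq"
  by (auto simp: zeros_def zero_seq_def conc_def fun_eq_iff)

lemma zeros_Suc: "zeros (Suc k) = False # zeros k"
  by (simp add: zeros_def)

lemma strip_zeros:
  "\<exists>a u. v @ [True] = zeros a @ u \<and> from_1_to_1 u"
proof (induction v)
  case Nil
  show ?case by (rule exI[of _ 0], rule exI[of _ "[True]"]) (simp add: zeros_def from_1_to_1_def)
next
  case (Cons b w)
  show ?case
  proof (cases b)
    case True
    then show ?thesis
      by (intro exI[of _ 0] exI[of _ "True # w @ [True]"]) (simp add: zeros_def from_1_to_1_def)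
  next
    case False
    from Cons obtain a u where "w @ [True] = zeros a @ u" "from_1_to_1 u" by blast
    with False show ?thesis
      by (intro exI[of _ "Suc a"] exI[of _ u]) (simp add: zeros_Suc)
  qed
qed

lemma occurs_in_append:
  assumes "occurs_in (p @ u) x"
  shows "occurs_in u x"
proof -
  obtain i where i: "x [i \<rightarrow> i + length (p @ u)] = p @ u"
    using assms unfolding occurs_in_def by blast
  have "drop (length p) (x [i \<rightarrow> i + length (p @ u)]) = u"
    unfolding i by simp
  then have "x [i + length p \<rightarrow> (i + length p) + length u] = u"
    by (simp add: add.assoc)
  then show ?thesis unfolding occurs_in_def by blast
qed

lemma from_1_to_1_words_cases:
  assumes "u \<in> from_1_to_1_words m Y"
  obtains "u = [True]"
  | a w where "u = True # zeros a @ w" "w \<in> from_1_to_1_words m Y"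
proof (cases "u = [True]")
  case False
  then obtain v where v: "u = True # (v @ [True])"
    using assms by (auto simp: from_1_to_1_words_def from_1_to_1_def)
  obtain a w where aw: "v @ [True] = zeros a @ w" "from_1_to_1 w"
    using strip_zeros by blast
  have u: "u = True # zeros a @ w" using v aw by simp
  obtain x where "x \<in> Y" "occurs_in ((True # zeros a) @ w) x"
    using assms u by (auto simp: from_1_to_1_words_def)
  then have "\<exists>x\<in>Y. occurs_in w x" using occurs_in_append by blast
  moreover have "count_list w True \<le> m"
    using assms u by (auto simp: from_1_to_1_words_def)
  ultimately show thesis using that(2)[OF u] aw by (auto simp: from_1_to_1_words_def)
qed (use that in blast)

lemma shift_map_P_set: "shift_map ` P_set n Y \<subseteq> P_set n Y"
proof
  fix y assume "y \<in> shift_map ` P_set n Y"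
  then obtain l z where "y = (shift_map ^^ Suc l) z"
    "z \<in> {(u @ zeros k)\<^sup>\<omega> | u k. k \<ge> 2 ^ (2 * n) \<and> u \<in> from_1_to_1_words (2 ^ n) Y}"
    unfolding P_set_def by auto
  then show "y \<in> P_set n Y" unfolding P_set_def by blast
qed

lemma shift_map_J'_set: "shift_map ` J'_set n Y \<subseteq> insert zero_seq (J'_set n Y)"
proof
  fix y assume "y \<in> shift_map ` J'_set n Y"
  then obtain \<alpha> u where y: "y = shift_map (zeros \<alpha> \<frown> u \<frown> zero_seq)"
    and u: "u \<in> from_1_to_1_words (2 ^ n) Y"
    unfolding J'_set_def by blast
  show "y \<in> insert zero_seq (J'_set n Y)"
  proof (cases \<alpha>)
    case (Suc b)
    then have "y = zeros b \<frown> u \<frown> zero_seq"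
      using y by (simp add: zeros_Suc shift_map_Cons shift_map_build)
    then show ?thesis using u unfolding J'_set_def by blast
  next
    case 0
    from u show ?thesis
    proof (cases rule: from_1_to_1_words_cases)
      case 1
      then show ?thesis using 0 y by (simp add: zeros_def shift_map_Cons shift_map_build)
    next
      case (2 a w)
      then have "y = zeros a \<frown> w \<frown> zero_seq"
        using 0 y by (simp add: zeros_def shift_map_Cons shift_map_build)
      then show ?thesis using 2 unfolding J'_set_def by blast
    qed
  qed
qed

lemma shift_map_J''_set: "shift_map ` J''_set n Y \<subseteq> J'_set n Y \<union> J''_set n Y"
proof
  fix y assume "y \<in> shift_map ` J''_set n Y"
  then obtain \<alpha> u \<beta> v
    where y: "y = shift_map (zeros \<alpha> \<frown> u \<frown> zeros \<beta> \<frown> v \<frown> zero_seq)"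
    and \<beta>: "\<beta> \<ge> 2 ^ (2 * n)"
    and u: "u \<in> from_1_to_1_words (2 ^ n) Y" and v: "v \<in> from_1_to_1_words (2 ^ n) Y"
    unfolding J''_set_def by blast
  show "y \<in> J'_set n Y \<union> J''_set n Y"
  proof (cases \<alpha>)
    case (Suc b)
    then have "y = zeros b \<frown> u \<frown> zeros \<beta> \<frown> v \<frown> zero_seq"
      using y by (simp add: zeros_Suc shift_map_Cons shift_map_build)
    then show ?thesis using u v \<beta> unfolding J''_set_def by blast
  next
    case 0
    from u show ?thesis
    proof (cases rule: from_1_to_1_words_cases)
      case 1
      then have "y = zeros \<beta> \<frown> v \<frown> zero_seq"
        using 0 y by (simp add: zeros_def shift_map_Cons shift_map_build)
      then show ?thesis using v unfolding J'_set_def by blast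
    next
      case (2 a w)
      then have "y = zeros a \<frown> w \<frown> zeros \<beta> \<frown> v \<frown> zero_seq"
        using 0 y by (simp add: zeros_def shift_map_Cons shift_map_build)
      then show ?thesis using 2 v \<beta> unfolding J''_set_def by blast
    qed
  qed
qed

lemma zero_seq_in_X_approx: "zero_seq \<in> X_approx n"
  by (induction n) auto

lemma shift_map_X_approx: "shift_map ` X_approx n \<subseteq> X_approx n"
proof (induction n)
  case 0
  show ?case
  proof
    fix y assume "y \<in> shift_map ` X_approx 0"
    then consider "y = shift_map zero_seq"
      | \<alpha> where "y = shift_map (zeros \<alpha> \<frown> [True] \<frown> zero_seq)"
      by auto
    then show "y \<in> X_approx 0"
    proof cases
      case 1
      then show ?thesis by (simp add: shift_map_zero_seq)
    next
      case (2 \<alpha>)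
      show ?thesis
      proof (cases \<alpha>)
        case 0
        then show ?thesis using 2 by (simp add: zeros_def shift_map_Cons shift_map_build)
      next
        case (Suc b)
        then have "y = zeros b \<frown> [True] \<frown> zero_seq"
          using 2 by (simp add: zeros_Suc shift_map_Cons shift_map_build)
        then show ?thesis by auto
      qed
    qed
  qed
next
  case (Suc n)
  define A where
    "A = P_set n (X_approx n) \<union> (J'_set n (X_approx n) \<union> J''_set n (X_approx n))"
  have "shift_map ` A \<subseteq> insert zero_seq A"
    unfolding A_def
    using shift_map_P_set[of n "X_approx n"] shift_map_J'_set[of n "X_approx n"]
      shift_map_J''_set[of n "X_approx n"]
    by blast
  then have "shift_map ` closure A \<subseteq> closure (insert zero_seq A)"
    by (intro shift_map_closure order_trans[OF _ closure_subset])
  also have "\<dots> = insert zero_seq (closure A)"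
    using closure_Un[of "{zero_seq}" A] closure_closed[OF closed_zero_seq]
    by (metis insert_is_Un)
  also have "\<dots> \<subseteq> X_approx n \<union> closure A"
    using zero_seq_in_X_approx[of n] by (intro insert_subsetI) auto
  finally have "shift_map ` (X_approx n \<union> closure A) \<subseteq> X_approx n \<union> closure A"
    unfolding image_Un by (intro Un_least le_supI1[OF Suc.IH])
  then show ?case
    unfolding A_def X_approx.simps .
qed

lemma shift_space_X_shift: "shift_space X_shift"
  unfolding shift_space_def X_shift_def
proof (intro conjI closed_closure shift_map_closure)
  show "shift_map ` (\<Union>n. X_approx n) \<subseteq> closure (\<Union>n. X_approx n)"
    using shift_map_X_approx closure_subset[of "\<Union>n. X_approx n"] by blast
qed

end

theory Submission
  imports Defs
begin

text \<open>
  A window of a point of \<open>X\<close> that starts and ends with the symbol 1 and does not occur in \<open>X\<^sub>n\<close>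
  contains a gap of length at least \<open>2\<^sup>2\<^sup>j\<close> between blocks with at most \<open>2\<^sup>j\<close> ones, for some
  \<open>j \<ge> n\<close>; hence its proportion of ones is \<open>O(2\<^sup>-\<^sup>n)\<close>. So the symbol 1 has density 0 along every
  orbit that avoids all of the \<open>X\<^sub>n\<close>.

  Let \<open>\<mu>\<close> be ergodic with support \<open>X\<close>. The set of points whose orbit enters \<open>X\<^sub>n\<close> is strictly
  invariant and has the measure of \<open>X\<^sub>n\<close>, which is less than 1 because \<open>X\<^sub>n\<close> is a closed proper
  subset of \<open>X\<close>: a point of \<open>X\<^sub>n\<close> with more than \<open>2\<^sup>n\<close> ones is periodic, while \<open>X\<close> has points
  with finitely many, but more than \<open>2\<^sup>n\<close>, ones. By ergodicity almost every orbit avoids all of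
  the \<open>X\<^sub>n\<close>, and dominated convergence gives \<open>\<mu>[1] = 0\<close>, a contradiction.
\<close>

section \<open>Windows, counts of ones and the product topology\<close>

definition ones :: "(nat \<Rightarrow> bool) \<Rightarrow> nat \<Rightarrow> nat \<Rightarrow> nat"
  where "ones x a b = (\<Sum>i=a..<b. of_bool (x i))"

text \<open>Both endpoints \<open>a\<close> and \<open>b\<close> belong to the window, so its ones
  are counted by \<open>ones x a (Suc b)\<close>.\<close>

definition seen_in :: "(nat \<Rightarrow> bool) set \<Rightarrow> (nat \<Rightarrow> bool) \<Rightarrow> nat \<Rightarrow> nat \<Rightarrow> bool"
  where "seen_in Y x a b \<longleftrightarrow> (\<exists>y\<in>Y. \<exists>c. \<forall>i\<le>b - a. y (c + i) = x (a + i))"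

text \<open>Basic open sets of the product constrain finitely many coordinates, and these all lie
  below some \<open>N\<close>. Every later limit argument goes through this form.\<close>

lemma closure_iff_prefixes:
  fixes S :: "(nat \<Rightarrow> bool) set"
  shows "x \<in> closure S \<longleftrightarrow> (\<forall>N. \<exists>y\<in>S. \<forall>i<N. y i = x i)"
proof
  assume x: "x \<in> closure S"
  show "\<forall>N. \<exists>y\<in>S. \<forall>i<N. y i = x i"
  proof
    fix N
    have "open {y :: nat \<Rightarrow> bool. y i = x i}" for i
    proof -
      have "{y :: nat \<Rightarrow> bool. y i = x i} = (\<lambda>y. y i) -` {x i}" by auto
      then show ?thesis
        using open_vimage[OF open_discrete continuous_on_product_coordinates] by metis
    qed
    then have "open (\<Inter>i\<in>{..<N}. {y :: nat \<Rightarrow> bool. y i = x i})"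
      by (intro open_INT) auto
    moreover have "x \<in> (\<Inter>i\<in>{..<N}. {y :: nat \<Rightarrow> bool. y i = x i})" by auto
    ultimately have "(\<Inter>i\<in>{..<N}. {y :: nat \<Rightarrow> bool. y i = x i}) \<inter> S \<noteq> {}"
      using x unfolding closure_iff_nhds_not_empty by blast
    then show "\<exists>y\<in>S. \<forall>i<N. y i = x i" by auto
  qed
next
  assume prefixes: "\<forall>N. \<exists>y\<in>S. \<forall>i<N. y i = x i"
  show "x \<in> closure S"
    unfolding closure_iff_nhds_not_empty
  proof (intro allI impI)
    fix V U :: "(nat \<Rightarrow> bool) set"
    assume U: "U \<subseteq> V" "open U" "x \<in> U"
    obtain B where B: "x \<in> Pi\<^sub>E UNIV B" "finite {i. B i \<noteq> UNIV}" "Pi\<^sub>E UNIV B \<subseteq> U"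
      using product_topology_open_contains_basis[OF U(2)[unfolded open_fun_def] U(3)]
      unfolding topspace_euclidean by blast
    obtain N where N: "\<forall>i\<in>{i. B i \<noteq> UNIV}. i < N"
      using finite_nat_bounded[OF B(2)] by blast
    obtain y where y: "y \<in> S" "\<forall>i<N. y i = x i" using prefixes by blast
    have "y i \<in> B i" for i
      using B(1) N y(2) by (cases "B i = UNIV") (auto simp: PiE_def Pi_def)
    then have "y \<in> Pi\<^sub>E UNIV B" by (auto simp: PiE_def)
    then show "S \<inter> V \<noteq> {}" using y(1) B(3) U(1) by blast
  qed
qed

lemma funpow_shift_map: "(shift_map ^^ l) x i = x (l + i)"
  by (induction l arbitrary: i) (auto simp: shift_map_def)

lemma ones_split: "a \<le> b \<Longrightarrow> b \<le> c \<Longrightarrow> ones x a c = ones x a b + ones x b c"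
  unfolding ones_def by (rule sum.atLeastLessThan_concat[symmetric])

lemma ones_mono: "a' \<le> a \<Longrightarrow> b \<le> b' \<Longrightarrow> ones x a b \<le> ones x a' b'"
  unfolding ones_def by (intro sum_mono2) auto

lemma ones_le_length: "ones x a b \<le> b - a"
  unfolding ones_def using sum_bounded_above[of "{a..<b}" "\<lambda>i. of_bool (x i)" "1::nat"] by simp

lemma ones_cong:
  assumes "\<And>i. i < n \<Longrightarrow> x (a + i) = y (b + i)"
  shows "ones x a (a + n) = ones y b (b + n)"
proof -
  have shift: "ones z c (c + n) = (\<Sum>i<n. of_bool (z (c + i)))" for z c
    unfolding ones_def using sum.shift_bounds_nat_ivl[of "\<lambda>i. of_bool (z i)" 0 c n]
    by (simp add: add.commute lessThan_atLeast0 del: sum_of_bool_eq)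
  show ?thesis unfolding shift using assms by (intro sum.cong) auto
qed

lemma count_list_True: "count_list w True = (\<Sum>i<length w. of_bool (w ! i))"
  by (induction w rule: rev_induct) (auto simp: nth_append)

lemma count_zeros [simp]: "count_list (zeros k) True = 0"
  by (auto simp: zeros_def count_list_0_iff)

lemma length_zeros [simp]: "length (zeros k) = k"
  by (simp add: zeros_def)

lemma ones_finite_le: "ones (w \<frown> zero_seq) a b \<le> count_list w True"
proof -
  have "ones (w \<frown> zero_seq) a b = (\<Sum>i\<in>{a..<b} \<inter> {..<length w}. of_bool ((w \<frown> zero_seq) i))"
    unfolding ones_def
    by (rule sum.mono_neutral_right) (auto simp: conc_def zero_seq_def)
  also have "\<dots> \<le> (\<Sum>i<length w. of_bool ((w \<frown> zero_seq) i))"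
    by (intro sum_mono2) auto
  finally show ?thesis by (simp add: count_list_True)
qed

lemma ones_finite: "ones (w \<frown> zero_seq) 0 (length w) = count_list w True"
  by (simp add: count_list_True ones_def lessThan_atLeast0)

lemma ones_iter:
  assumes "w \<noteq> []"
  shows "ones (w\<^sup>\<omega>) (q * length w) ((q + h) * length w) = h * count_list w True"
proof (induction h)
  case (Suc h)
  have "ones (w\<^sup>\<omega>) ((q + h) * length w) ((q + h) * length w + length w)
      = ones (w\<^sup>\<omega>) 0 (0 + length w)"
    using assms by (intro ones_cong) simp
  also have "\<dots> = count_list w True"
    using assms by (simp add: ones_def lessThan_atLeast0 count_list_True)
  finally show ?case
    using Suc ones_split[of "q * length w" "(q + h) * length w" "(q + Suc h) * length w" "w\<^sup>\<omega>"]
    by (simp add: algebra_simps)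
qed (simp add: ones_def)

section \<open>Sparsity of ones in windows not yet seen\<close>

lemma from_1_to_1_words_nonempty: "u \<in> from_1_to_1_words m Y \<Longrightarrow> u \<noteq> []"
  by (auto simp: from_1_to_1_words_def from_1_to_1_def)

lemma from_1_to_1_words_count: "u \<in> from_1_to_1_words m Y \<Longrightarrow> count_list u True \<le> m"
  by (auto simp: from_1_to_1_words_def)

lemma seen_in_word:
  assumes "u \<in> from_1_to_1_words m Y"
    and z: "\<And>j. j < length u \<Longrightarrow> z (s + j) = u ! j"
    and "s \<le> a" "a \<le> b" "b < s + length u"
  shows "seen_in Y z a b"
proof -
  obtain y c where "y \<in> Y" and c: "y [c \<rightarrow> c + length u] = u"
    using assms(1) by (auto simp: from_1_to_1_words_def occurs_in_def)
  have y: "y (c + j) = u ! j" if "j < length u" for j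
    using that arg_cong[OF c, of "\<lambda>w. w ! j"] by (simp add: subsequence_def)
  have "y (c + (a - s) + i) = z (a + i)" if "i \<le> b - a" for i
    using y[of "a - s + i"] z[of "a - s + i"] that assms(3-) by (simp add: add.assoc)
  then show ?thesis using \<open>y \<in> Y\<close> unfolding seen_in_def by blast
qed

text \<open>With \<open>k \<ge> m\<^sup>2\<close>: a window that is not inside one copy of \<open>u\<close> contains \<open>g \<ge> 1\<close> full gaps \<open>0\<^sup>k\<close> and meets
  at most \<open>g + 1\<close> copies of \<open>u\<close>.\<close>

lemma sparse_iter:
  assumes u: "u \<in> from_1_to_1_words m Y" and k: "m * m \<le> k"
    and ab: "a \<le> b" and za: "(u @ zeros k)\<^sup>\<omega> a" and zb: "(u @ zeros k)\<^sup>\<omega> b"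
    and unseen: "\<not> seen_in Y ((u @ zeros k)\<^sup>\<omega>) a b"
  shows "ones ((u @ zeros k)\<^sup>\<omega>) a (Suc b) * m \<le> 2 * (b - a)"
proof -
  define w p where "w = u @ zeros k" and "p = length u + k"
  have w: "w \<noteq> []" "length w = p" "count_list w True \<le> m" "p > 0"
    using from_1_to_1_words_nonempty[OF u] from_1_to_1_words_count[OF u] by (auto simp: w_def p_def)
  have u_pos: "i mod p < length u" if "w\<^sup>\<omega> i" for i
  proof (rule ccontr)
    define r where "r = i mod p"
    assume "\<not> i mod p < length u"
    moreover have "r < p" using w(4) by (simp add: r_def)
    ultimately have "\<not> w ! r" by (simp add: w_def nth_append zeros_def r_def p_def)
    then show False using that w(1,2) by (simp add: r_def iter_def)
  qed
  define q h where "q = a div p" and "h = b div p"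
  have a: "a = q * p + a mod p" and b: "b = h * p + b mod p" by (auto simp: q_def h_def)
  have am: "a mod p < length u" and bm: "b mod p < length u"
    using u_pos za zb by (auto simp: w_def)
  have "q \<le> h" unfolding q_def h_def using ab div_le_mono by blast
  \<comment> \<open>The symbols at \<open>a\<close> and \<open>b\<close> are 1, so both positions
    lie in the \<open>u\<close> part of their periods. In a common period the whole window would sit
    inside one copy of \<open>u\<close>, a word of \<open>Y\<close>.\<close>
  have "q \<noteq> h"
  proof
    assume "q = h"
    have "w\<^sup>\<omega> (q * p + j) = u ! j" if "j < length u" for j
      using that w by (simp add: p_def) (simp add: w_def nth_append)
    then have "seen_in Y (w\<^sup>\<omega>) a b"
      by (rule seen_in_word[OF u]) (use a b ab am bm \<open>q = h\<close> in auto)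
    then show False using unseen by (simp add: w_def)
  qed
  \<comment> \<open>The window contains the \<open>Suc g\<close> zero gaps ending the periods
    \<open>q\<close>, ..., \<open>h - 1\<close> and lies within the \<open>g + 2\<close> periods
    \<open>q\<close>, ..., \<open>h\<close>. The constant 2 in the conclusion comes from g + 2 \<le>
    2 * Suc g.\<close>
  then obtain g where g: "h = q + Suc g"
    using \<open>q \<le> h\<close> by (metis le_neq_implies_less less_natE add_Suc_right)
  have "(Suc g) * k + a \<le> b"
  proof -
    have "Suc g * k \<le> g * p + k" by (simp add: p_def)
    then show ?thesis using a b am g by (simp add: p_def algebra_simps)
  qed
  then have len: "Suc g * k \<le> b - a" by simp
  have "Suc b \<le> (q + (g + 2)) * p"
    using b bm g by (simp add: p_def algebra_simps)
  then have "ones (w\<^sup>\<omega>) a (Suc b) \<le> ones (w\<^sup>\<omega>) (q * p) ((q + (g + 2)) * p)"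
    using a by (intro ones_mono) linarith+
  also have "\<dots> = (g + 2) * count_list w True" using ones_iter[OF w(1)] w(2) by metis
  also have "\<dots> \<le> 2 * Suc g * m" using w(3) by (intro mult_le_mono) auto
  finally have "ones (w\<^sup>\<omega>) a (Suc b) * m \<le> 2 * (Suc g * (m * m))"
    by (metis mult.assoc mult_le_mono1)
  also have "\<dots> \<le> 2 * (Suc g * k)" using k by (meson mult_le_mono2)
  also have "\<dots> \<le> 2 * (b - a)" using len by simp
  finally show ?thesis by (simp add: w_def)
qed

text \<open>Periodic points reduce to \<open>sparse_iter\<close> after undoing the shift. In
  \<open>J'_set\<close> all ones lie in a single word, so no unseen window exists. In
  \<open>J''_set\<close> an unseen window must span the gap of length at least 2^(2n), while the
  whole point has at most 2 * 2^n ones.\<close>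

lemma sparse_block_set:
  assumes y: "y \<in> P_set n Y \<union> (J'_set n Y \<union> J''_set n Y)"
    and ab: "a \<le> b" "y a" "y b" and unseen: "\<not> seen_in Y y a b"
  shows "ones y a (Suc b) * 2 ^ n \<le> 2 * (b - a)"
  using y
proof (elim UnE)
  assume "y \<in> P_set n Y"
  then obtain l u k where yl: "y = (shift_map ^^ l) ((u @ zeros k)\<^sup>\<omega>)"
    and k: "k \<ge> 2 ^ (2 * n)" and u: "u \<in> from_1_to_1_words (2 ^ n) Y"
    unfolding P_set_def by blast
  define z where "z = (u @ zeros k)\<^sup>\<omega>"
  have y: "y i = z (l + i)" for i using yl by (simp add: funpow_shift_map z_def)
  have "seen_in Y y a b" if "seen_in Y z (l + a) (l + b)"
    using that unfolding seen_in_def by (simp add: y add.assoc)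
  then have "ones z (l + a) (Suc (l + b)) * 2 ^ n \<le> 2 * (l + b - (l + a))"
    unfolding z_def using ab unseen k
    by (intro sparse_iter[OF u]) (auto simp: y z_def simp flip: power_add mult_2)
  moreover have "ones y a (a + (Suc b - a)) = ones z (l + a) (l + a + (Suc b - a))"
    by (rule ones_cong) (simp add: y add.assoc)
  ultimately show ?thesis using ab by simp
next
  assume "y \<in> J'_set n Y"
  then obtain \<alpha> u where y: "y = zeros \<alpha> \<frown> u \<frown> zero_seq" and u: "u \<in> from_1_to_1_words (2 ^ n) Y"
    unfolding J'_set_def by blast
  have pos: "\<alpha> \<le> i \<and> i < \<alpha> + length u" if "y i" for i
    using that by (auto simp: y conc_def zeros_def zero_seq_def split: if_splits)
  have "seen_in Y y a b"
    by (rule seen_in_word[OF u, of y \<alpha>]) (use pos ab in \<open>auto simp: y conc_def\<close>)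
  with unseen show ?thesis by simp
next
  assume "y \<in> J''_set n Y"
  then obtain \<alpha> u \<beta> v where y: "y = zeros \<alpha> \<frown> u \<frown> zeros \<beta> \<frown> v \<frown> zero_seq"
    and \<beta>: "\<beta> \<ge> 2 ^ (2 * n)"
    and u: "u \<in> from_1_to_1_words (2 ^ n) Y" and v: "v \<in> from_1_to_1_words (2 ^ n) Y"
    unfolding J''_set_def by blast
  have pos: "\<alpha> \<le> i \<and> i < \<alpha> + length u \<or>
      \<alpha> + length u + \<beta> \<le> i \<and> i < \<alpha> + length u + \<beta> + length v" if "y i" for i
    using that by (auto simp: y conc_def zeros_def zero_seq_def split: if_splits)
  have "\<not> (\<alpha> \<le> a \<and> b < \<alpha> + length u)"
    using seen_in_word[OF u, of y \<alpha> a b] unseen ab by (auto simp: y conc_def)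
  moreover have "\<not> (\<alpha> + length u + \<beta> \<le> a \<and> b < \<alpha> + length u + \<beta> + length v)"
    using seen_in_word[OF v, of y "\<alpha> + length u + \<beta>" a b] unseen ab by (auto simp: y conc_def)
  ultimately have len: "\<beta> \<le> b - a" using pos[OF ab(2)] pos[OF ab(3)] ab(1) by linarith
  have "ones y a (Suc b) \<le> count_list (zeros \<alpha> @ u @ zeros \<beta> @ v) True"
    using ones_finite_le[of "zeros \<alpha> @ u @ zeros \<beta> @ v" a "Suc b"] by (simp add: y)
  also have "\<dots> \<le> 2 * 2 ^ n"
    using from_1_to_1_words_count[OF u] from_1_to_1_words_count[OF v] by simp
  finally have "ones y a (Suc b) * 2 ^ n \<le> 2 * 2 ^ n * 2 ^ n" by (rule mult_le_mono1)
  also have "\<dots> = 2 * 2 ^ (2 * n)" unfolding mult.assoc by (simp only: mult_2 power_add)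
  also have "\<dots> \<le> 2 * (b - a)" using \<beta> len by simp
  finally show ?thesis .
qed

lemma X_approx_mono: "m \<le> n \<Longrightarrow> X_approx m \<subseteq> X_approx n"
  by (rule lift_Suc_mono_le) auto

text \<open>Induction finds the stage \<open>Suc j\<close> at which the window first appears. Being
  absent from stage \<open>n\<close>, it forces n \<le> j, so the bound of that stage, with factor
  2^j, is at least as strong. If it appears in a limit point, a point of the block sets with the
  same long prefix shows it too.\<close>

lemma sparse_X_approx:
  assumes "\<not> seen_in (X_approx n) x a b" "seen_in (X_approx j) x a b" "a \<le> b" "x a" "x b"
  shows "ones x a (Suc b) * 2 ^ n \<le> 2 * (b - a)"
  using assms(2)
proof (induction j)
  case 0
  then show ?case using assms(1) X_approx_mono[of 0 n] unfolding seen_in_def by blast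
next
  case (Suc j)
  show ?case
  proof (cases "seen_in (X_approx j) x a b")
    case False
    have "\<not> Suc j \<le> n"
      using Suc.prems assms(1) X_approx_mono[of "Suc j" n] unfolding seen_in_def by blast
    then have nj: "(2::nat) ^ n \<le> 2 ^ j" by simp
    define A where "A = P_set j (X_approx j) \<union> (J'_set j (X_approx j) \<union> J''_set j (X_approx j))"
    obtain y c where "y \<in> X_approx (Suc j)" and y: "\<And>i. i \<le> b - a \<Longrightarrow> y (c + i) = x (a + i)"
      using Suc.prems unfolding seen_in_def by blast
    moreover from this False have "y \<notin> X_approx j" unfolding seen_in_def by blast
    ultimately have "y \<in> closure A" by (auto simp: A_def)
    then obtain z where z: "z \<in> A" "\<forall>i<Suc (c + (b - a)). z i = y i"
      unfolding closure_iff_prefixes by blast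
    have zx: "z (c + i) = x (a + i)" if "i \<le> b - a" for i
      using that z(2) y by simp
    have "\<not> seen_in (X_approx j) z c (c + (b - a))"
      using False zx unfolding seen_in_def by auto
    then have "ones z c (Suc (c + (b - a))) * 2 ^ j \<le> 2 * (c + (b - a) - c)"
      using z(1) zx[of 0] zx[of "b - a"] assms(3-) unfolding A_def
      by (intro sparse_block_set) auto
    moreover have "ones z c (c + Suc (b - a)) = ones x a (a + Suc (b - a))"
      by (rule ones_cong) (simp add: zx)
    ultimately have "ones x a (Suc b) * 2 ^ j \<le> 2 * (b - a)" using assms(3) by simp
    moreover have "ones x a (Suc b) * 2 ^ n \<le> ones x a (Suc b) * 2 ^ j" using nj by simp
    ultimately show ?thesis by linarith
  qed (rule Suc.IH)
qed

text \<open>A finite window of a point of the closure already occurs in some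
  \<open>X_approx j\<close>.\<close>

lemma sparse_X_shift:
  assumes "x \<in> X_shift" "\<not> seen_in (X_approx n) x a b" "a \<le> b" "x a" "x b"
  shows "ones x a (Suc b) * 2 ^ n \<le> 2 * (b - a)"
proof -
  obtain j y where "y \<in> X_approx j" "\<forall>i<Suc b. y i = x i"
    using assms(1) unfolding X_shift_def closure_iff_prefixes by blast
  then have "seen_in (X_approx j) x a b"
    unfolding seen_in_def using assms(3) by (intro bexI[of _ y] exI[of _ a]) auto
  then show ?thesis using sparse_X_approx assms by blast
qed

section \<open>Each stage is a closed proper subset of X\<close>

lemma closed_X_approx: "closed (X_approx n)"
proof (induction n)
  case 0
  have "x \<in> X_approx 0" if x: "x \<in> closure (X_approx 0)" for x
  proof (cases "\<exists>p. x p")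
    case True
    then obtain p where p: "x p" by blast
    have single: "zeros \<alpha> \<frown> [True] \<frown> zero_seq = (\<lambda>i. i = \<alpha>)" for \<alpha>
      by (auto simp: fun_eq_iff conc_def zeros_def zero_seq_def)
    have X0: "y = zero_seq \<or> (\<exists>\<alpha>. y = (\<lambda>i. i = \<alpha>))" if "y \<in> X_approx 0" for y
      using that single unfolding X_approx.simps by blast
    \<comment> \<open>Two ones of a limit point lie in a common prefix, hence in a point of
      \<open>X_approx 0\<close>, which has at most one.\<close>
    have "i = p" if "x i" for i
    proof -
      obtain y where "y \<in> X_approx 0" "\<forall>j<Suc (max i p). y j = x j"
        using x unfolding closure_iff_prefixes by blast
      then have "y i" "y p" and y: "y \<in> X_approx 0" using p that by auto
      show "i = p" using X0[OF y] \<open>y i\<close> \<open>y p\<close> by (auto simp: zero_seq_def)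
    qed
    then have "x = zeros p \<frown> [True] \<frown> zero_seq" unfolding single using p by blast
    then show ?thesis unfolding X_approx.simps by blast
  next
    case False
    then have "x = zero_seq" by (auto simp: zero_seq_def)
    then show ?thesis by simp
  qed
  then show ?case using closure_subset_eq by blast
qed auto

text \<open>In the closure step, a prefix of length \<open>N\<close> with too many ones forces the approximating
  periodic points to have period less than \<open>N\<close>, hence all of them to have period \<open>N!\<close>.\<close>

lemma X_approx_few_ones_or_periodic:
  assumes "x \<in> X_approx m"
  shows "(\<forall>N. ones x 0 N \<le> 2 ^ m) \<or> (\<exists>p>0. \<forall>i. x (i + p) = x i)"
  using assms
proof (induction m arbitrary: x)
  case 0
  have "ones zero_seq 0 N \<le> 1" for N by (simp add: ones_def zero_seq_def)
  moreover have "ones (zeros \<alpha> \<frown> [True] \<frown> zero_seq) 0 N \<le> 1" for \<alpha> N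
    using ones_finite_le[of "zeros \<alpha> @ [True]" 0 N] by simp
  ultimately show ?case using 0 by auto
next
  case (Suc m)
  show ?case
  proof (cases "(\<forall>N. ones x 0 N \<le> 2 ^ Suc m) \<or> x \<in> X_approx m")
    case True
    then show ?thesis
    proof
      assume "x \<in> X_approx m"
      moreover have "r \<le> 2 ^ Suc m" if "r \<le> 2 ^ m" for r :: nat
        using that by simp
      ultimately show ?thesis using Suc.IH by blast
    qed blast
  next
    case False
    then obtain N where N: "ones x 0 N > 2 ^ Suc m" by (auto simp: not_le)
    have x_closure: "x \<in> closure (P_set m (X_approx m) \<union> (J'_set m (X_approx m) \<union> J''_set m (X_approx m)))"
      using Suc.prems False by simp
    have "x (i + fact N) = x i" for i
    proof -
      \<comment> \<open>The agreed prefix covers both the first \<open>N\<close> symbols, where the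
        ones are counted, and the positions \<open>i\<close> and \<open>i + fact N\<close> to be
        compared.\<close>
      obtain y where y: "y \<in> P_set m (X_approx m) \<union> (J'_set m (X_approx m) \<union> J''_set m (X_approx m))"
        and yx: "\<forall>j<N + Suc (i + fact N). y j = x j"
        using x_closure unfolding closure_iff_prefixes by blast
      have "ones y 0 (0 + N) = ones x 0 (0 + N)" using yx by (intro ones_cong) auto
      then have Ny: "ones y 0 N > 2 ^ Suc m" using N by simp
      \<comment> \<open>Points of \<open>J'_set\<close> and \<open>J''_set\<close> carry at most two
        words, hence at most 2 * 2^m ones, too few for the prefix of length
        \<open>N\<close>.\<close>
      have "y \<notin> J'_set m (X_approx m)"
      proof
        assume "y \<in> J'_set m (X_approx m)"
        then obtain \<alpha> u where "y = (zeros \<alpha> @ u) \<frown> zero_seq"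
          "u \<in> from_1_to_1_words (2 ^ m) (X_approx m)"
          unfolding J'_set_def by auto
        then show False
          using Ny ones_finite_le[of "zeros \<alpha> @ u" 0 N]
            from_1_to_1_words_count[of u "2 ^ m" "X_approx m"] by simp
      qed
      moreover have "y \<notin> J''_set m (X_approx m)"
      proof
        assume "y \<in> J''_set m (X_approx m)"
        then obtain \<alpha> u \<beta> v where "y = (zeros \<alpha> @ u @ zeros \<beta> @ v) \<frown> zero_seq"
          and u: "u \<in> from_1_to_1_words (2 ^ m) (X_approx m)"
          and v: "v \<in> from_1_to_1_words (2 ^ m) (X_approx m)"
          unfolding J''_set_def by auto
        then show False
          using Ny ones_finite_le[of "zeros \<alpha> @ u @ zeros \<beta> @ v" 0 N]
            from_1_to_1_words_count[OF u] from_1_to_1_words_count[OF v] by simp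
      qed
      ultimately obtain l u k where yl: "y = (shift_map ^^ l) ((u @ zeros k)\<^sup>\<omega>)"
        and u: "u \<in> from_1_to_1_words (2 ^ m) (X_approx m)"
        using y unfolding P_set_def by blast
      define w where "w = u @ zeros k"
      have w: "w \<noteq> []" "count_list w True \<le> 2 ^ m"
        using from_1_to_1_words_nonempty[OF u] from_1_to_1_words_count[OF u] by (auto simp: w_def)
      have yw: "y j = w\<^sup>\<omega> (l + j)" for j using yl by (simp add: funpow_shift_map w_def)
      \<comment> \<open>A window no longer than the period lies within two consecutive periods,
        hence has at most 2 * 2^m ones.\<close>
      have "length w < N"
      proof (rule ccontr)
        assume "\<not> length w < N"
        then have Nw: "N \<le> length w" by simp
        define q where "q = l div length w"
        have "l = q * length w + l mod length w" by (simp add: q_def)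
        moreover have "l mod length w < length w" using w by simp
        ultimately have l: "q * length w \<le> l" "l + N \<le> (q + 2) * length w"
          using Nw by (auto simp: algebra_simps)
        have "ones y 0 (0 + N) = ones (w\<^sup>\<omega>) l (l + N)" by (rule ones_cong) (simp add: yw)
        also have "\<dots> \<le> ones (w\<^sup>\<omega>) (q * length w) ((q + 2) * length w)"
          using l by (intro ones_mono)
        also have "\<dots> \<le> 2 ^ Suc m" using w ones_iter[OF w(1), of q 2] by simp
        finally show False using Ny by simp
      qed
      then have "length w dvd fact N" using w(1) by (intro dvd_fact) (auto simp: Suc_le_eq)
      then obtain t where "fact N = length w * t" by (auto elim: dvdE)
      then have "(l + (i + fact N)) mod length w = (l + i) mod length w"
        by (simp flip: add.assoc)
      then have "y (i + fact N) = y i" using w(1) by (simp add: yw)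
      then show ?thesis using yx by simp
    qed
    then show ?thesis by (intro disjI2 exI[of _ "fact N"]) auto
  qed
qed

lemma occurs_in_conc: "occurs_in u (zeros \<alpha> \<frown> u \<frown> x)"
  unfolding occurs_in_def
  by (intro exI[of _ \<alpha>] nth_equalityI) (auto simp: subsequence_def conc_def)

text \<open>Doubling: two copies of \<open>u\<close> separated by 2^(2m) zeros occur in a point of
  \<open>J''_set\<close>, so they form a word of the next stage with twice as many ones.\<close>

lemma ex_from_1_to_1_word_count: "\<exists>u\<in>from_1_to_1_words (2 ^ m) (X_approx m). count_list u True = 2 ^ m"
proof (induction m)
  case 0
  have "zeros 0 \<frown> [True] \<frown> zero_seq \<in> X_approx 0" by auto
  then have "\<exists>x\<in>X_approx 0. occurs_in [True] x" using occurs_in_conc by blast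
  then show ?case
    by (intro bexI[of _ "[True]"]) (auto simp: from_1_to_1_words_def from_1_to_1_def)
next
  case (Suc m)
  then obtain u where u: "u \<in> from_1_to_1_words (2 ^ m) (X_approx m)" "count_list u True = 2 ^ m"
    by blast
  define w where "w = u @ zeros (2 ^ (2 * m)) @ u"
  have "zeros 0 \<frown> u \<frown> zeros (2 ^ (2 * m)) \<frown> u \<frown> zero_seq \<in> J''_set m (X_approx m)"
    unfolding J''_set_def using u(1) by blast
  then have "zeros 0 \<frown> w \<frown> zero_seq \<in> X_approx (Suc m)"
    using closure_subset by (auto simp: w_def)
  then have "\<exists>x\<in>X_approx (Suc m). occurs_in w x" using occurs_in_conc by blast
  moreover have "from_1_to_1 w"
  proof -
    from u(1) consider "u = [True]" | v where "u = True # v @ [True]"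
      by (auto simp: from_1_to_1_words_def from_1_to_1_def)
    then obtain r s where "u = True # r" "u = s @ [True]"
      by cases (auto intro: that[of "[]" "[]"] that[of "v @ [True]" "True # v" for v])
    then have "w = [True] @ (r @ zeros (2 ^ (2 * m)) @ s) @ [True]"
      unfolding w_def by (metis append.assoc append_Cons append_Nil)
    then show ?thesis unfolding from_1_to_1_def by blast
  qed
  moreover have "count_list w True = 2 ^ Suc m" using u(2) by (simp add: w_def)
  ultimately show ?case unfolding from_1_to_1_words_def by auto
qed

lemma X_approx_subset_X_shift: "X_approx n \<subseteq> X_shift"
  unfolding X_shift_def by (rule order_trans[OF UN_upper closure_subset]) simp

text \<open>The witness is a word with 2^(m+1) ones followed by zeros. Its count rules out the first
  alternative of \<open>X_approx_few_ones_or_periodic\<close>; a period would repeat its initial 1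
  at \<open>length u * p\<close>, past the end of \<open>u\<close>.\<close>

lemma X_approx_proper_subset: "\<exists>x\<in>X_shift. x \<notin> X_approx m"
proof -
  obtain u where u: "u \<in> from_1_to_1_words (2 ^ Suc m) (X_approx (Suc m))"
    and cu: "count_list u True = 2 ^ Suc m"
    using ex_from_1_to_1_word_count by blast
  define x where "x = zeros 0 \<frown> u \<frown> zero_seq"
  have "x \<in> J'_set (Suc m) (X_approx (Suc m))" unfolding J'_set_def x_def using u by blast
  then have "x \<in> X_approx (Suc (Suc m))"
    unfolding X_approx.simps by (intro UnI2 subsetD[OF closure_subset] UnI1)
  then have "x \<in> X_shift" using X_approx_subset_X_shift by blast
  moreover have "x \<notin> X_approx m"
  proof
    assume "x \<in> X_approx m"
    moreover have "\<not> ones x 0 (length u) \<le> 2 ^ m"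
      using cu by (simp add: x_def zeros_def ones_finite)
    ultimately obtain p where p: "p > 0" "\<And>i. x (i + p) = x i"
      using X_approx_few_ones_or_periodic by blast
    have per: "x (i + t * p) = x i" for i t
    proof (induction t)
      case (Suc t)
      then show ?case using p(2)[of "i + t * p"] by (simp add: ac_simps)
    qed simp
    have "x 0" using u by (auto simp: x_def zeros_def from_1_to_1_words_def from_1_to_1_def)
    then have "x (length u * p)" using per[of 0 "length u"] by simp
    moreover have "length u \<le> length u * p" using p(1) by simp
    ultimately show False using p(1) by (auto simp: x_def zeros_def zero_seq_def conc_def split: if_splits)
  qed
  ultimately show ?thesis by blast
qed

section \<open>Zero density of ones along orbits avoiding every stage\<close>

lemma ones_eq_0: "(\<And>i. a \<le> i \<Longrightarrow> i < b \<Longrightarrow> \<not> x i) \<Longrightarrow> ones x a b = 0"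
  unfolding ones_def by (intro sum.neutral) auto

text \<open>All ones of the prefix of length \<open>N\<close> lie between its first one
  \<open>p\<close> and its last one \<open>q\<close>. If this window is unseen in
  \<open>X_approx n\<close>, sparsity bounds its ones; if it is seen, its length is at most a
  constant independent of \<open>N\<close>.\<close>

lemma ones_le_affine:
  assumes "x \<in> X_shift" and avoid: "\<And>l. (shift_map ^^ l) x \<notin> X_approx n"
  shows "\<exists>N\<^sub>0. \<forall>N. ones x 0 N * 2 ^ n \<le> N\<^sub>0 * 2 ^ n + 2 * N"
proof (cases "\<exists>p. x p")
  case False
  then show ?thesis by (simp add: ones_eq_0)
next
  case True
  define p where "p = (LEAST i. x i)"
  have xp: "x p" and pmin: "\<And>i. x i \<Longrightarrow> p \<le> i"
    using True LeastI_ex Least_le unfolding p_def by metis+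
  \<comment> \<open>Closedness makes avoidance quantitative: one prefix length
    \<open>N\<^sub>0\<close> separates the shifted point from all of
    \<open>X_approx n\<close>.\<close>
  have "(shift_map ^^ p) x \<notin> closure (X_approx n)"
    using avoid closed_X_approx by (simp add: closure_closed)
  then obtain N\<^sub>0 where N\<^sub>0: "\<And>y. y \<in> X_approx n \<Longrightarrow> \<exists>i<N\<^sub>0. y i \<noteq> x (p + i)"
    unfolding closure_iff_prefixes by (auto simp: funpow_shift_map)
  have "ones x 0 N * 2 ^ n \<le> N\<^sub>0 * 2 ^ n + 2 * N" for N
  proof (cases "\<exists>i<N. x i")
    case False
    then show ?thesis by (simp add: ones_eq_0)
  next
    case True
    define q where "q = Max {i. i < N \<and> x i}"
    have fin: "finite {i. i < N \<and> x i}" by simp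
    have q: "q < N" "x q" using Max_in[OF fin] True unfolding q_def by auto
    have qmax: "i \<le> q" if "i < N" "x i" for i using Max_ge[OF fin] that unfolding q_def by simp
    have pq: "p \<le> q" using pmin q by simp
    have "ones x 0 p = 0" using pmin by (intro ones_eq_0) (meson not_le)
    moreover have "ones x (Suc q) N = 0" using qmax by (intro ones_eq_0) force
    ultimately have ones: "ones x 0 N = ones x p (Suc q)"
      using ones_split[of 0 p N x] ones_split[of p "Suc q" N x] pq q by simp
    show ?thesis
    proof (cases "seen_in (X_approx n) x p q")
      case True
      then obtain y c where y: "y \<in> X_approx n" "\<And>i. i \<le> q - p \<Longrightarrow> y (c + i) = x (p + i)"
        unfolding seen_in_def by blast
      \<comment> \<open>Shift invariance moves the occurrence at \<open>c\<close> to the front,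
        where \<open>N\<^sub>0\<close> limits the length of agreement.\<close>
      have "(shift_map ^^ c) y \<in> X_approx n"
        using y(1) shift_map_X_approx by (induction c) auto
      then obtain i where "i < N\<^sub>0" "y (c + i) \<noteq> x (p + i)"
        using N\<^sub>0[of "(shift_map ^^ c) y"] unfolding funpow_shift_map by blast
      then have "q - p < N\<^sub>0" using y(2)[of i] by (cases "i \<le> q - p") auto
      then have "ones x 0 N \<le> N\<^sub>0" using ones ones_le_length[of x p "Suc q"] by linarith
      then have "ones x 0 N * 2 ^ n \<le> N\<^sub>0 * 2 ^ n" by (rule mult_le_mono1)
      then show ?thesis by (rule trans_le_add1)
    next
      case False
      then show ?thesis using sparse_X_shift[OF assms(1) False pq xp q(2)] ones q(1) by simp
    qed
  qed
  then show ?thesis by blast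
qed

lemma density_ones_0:
  assumes "x \<in> X_shift" and avoid: "\<And>n l. (shift_map ^^ l) x \<notin> X_approx n"
  shows "(\<lambda>N. real (ones x 0 N) / real N) \<longlonglongrightarrow> 0"
proof (rule LIMSEQ_I)
  fix r :: real
  assume r: "r > 0"
  \<comment> \<open>This \<open>n\<close> makes the slope 2 / 2^n less than r / 2; \<open>K\<close>
    below makes the constant term, divided by \<open>N\<close>, less than r / 2 as well.\<close>
  obtain n where "4 / r < 2 ^ n" using real_arch_pow[of 2] by auto
  then have n: "2 / 2 ^ n < r / 2" using r by (simp add: field_simps)
  obtain N\<^sub>0 where N\<^sub>0: "\<And>N. ones x 0 N * 2 ^ n \<le> N\<^sub>0 * 2 ^ n + 2 * N"
    using ones_le_affine[OF assms] by blast
  obtain K where K: "real K > 2 * real N\<^sub>0 / r" using reals_Archimedean2 by blast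
  have "norm (real (ones x 0 N) / real N - 0) < r" if N: "Suc K \<le> N" for N
  proof -
    have "real N > 0" using N by simp
    have "real (ones x 0 N) * 2 ^ n \<le> real N\<^sub>0 * 2 ^ n + 2 * real N"
      using N\<^sub>0[of N] by (simp flip: of_nat_le_iff[where 'a=real])
    then have "real (ones x 0 N) \<le> real N\<^sub>0 + 2 / 2 ^ n * real N"
      by (simp add: field_simps)
    also have "\<dots> < r / 2 * real N + r / 2 * real N"
    proof (rule add_strict_mono)
      have "2 * real N\<^sub>0 / r < real N" using K N by simp
      then show "real N\<^sub>0 < r / 2 * real N" using r by (simp add: field_simps)
      show "2 / 2 ^ n * real N < r / 2 * real N" using n \<open>real N > 0\<close> by (rule mult_strict_right_mono)
    qed
    finally show ?thesis using \<open>real N > 0\<close> by (simp add: field_simps)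
  qed
  then show "\<exists>no. \<forall>N\<ge>no. norm (real (ones x 0 N) / real N - 0) < r" by blast
qed

section \<open>Ergodicity and the contradiction\<close>

lemma measurable_funpow: "T \<in> measurable M M \<Longrightarrow> T ^^ l \<in> measurable M M"
  by (induction l) (auto intro: measurable_comp)

lemma distr_funpow:
  assumes "invariant_measure T M"
  shows "distr M M (T ^^ l) = M"
proof (induction l)
  case 0
  show ?case using distr_id[of M] by (simp add: id_def)
next
  case (Suc l)
  have T: "T \<in> measurable M M" using assms by (simp add: invariant_measure_def)
  have "distr M M (T ^^ Suc l) = distr (distr M M (T ^^ l)) M T"
    using distr_distr[OF T measurable_funpow[OF T]] by simp
  then show ?case using Suc assms by (simp add: invariant_measure_def comp_def)
qed

lemma emeasure_funpow_vimage:
  assumes "invariant_measure T M" "A \<in> sets M"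
  shows "emeasure M ((T ^^ l) -` A \<inter> space M) = emeasure M A"
  using emeasure_distr[OF measurable_funpow assms(2)] distr_funpow[OF assms(1)] assms(1)
  by (metis invariant_measure_def)

lemma space_borel_measure_on: "borel_measure_on S M \<Longrightarrow> space M = S"
  unfolding borel_measure_on_def by (drule sets_eq_imp_space_eq) (simp add: space_restrict_space)

lemma sets_borel_measure_on: "borel_measure_on S M \<Longrightarrow> A \<in> sets borel \<Longrightarrow> S \<inter> A \<in> sets M"
  by (auto simp: borel_measure_on_def sets_restrict_space)

lemma AE_orbit_avoids_X_approx:
  assumes borel: "borel_measure_on X_shift M" and ergodic: "ergodic_measure shift_map M"
    and full: "full_support_on X_shift M"
  shows "AE x in M. \<forall>l. (shift_map ^^ l) x \<notin> X_approx n"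
proof -
  interpret prob_space M using ergodic by (simp add: ergodic_measure_def)
  have inv: "invariant_measure shift_map M" using ergodic by (simp add: ergodic_measure_def)
  then have T: "shift_map \<in> measurable M M" by (simp add: invariant_measure_def)
  have space: "space M = X_shift" using space_borel_measure_on[OF borel] .
  have Xn: "X_approx n \<in> sets M"
    using sets_borel_measure_on[OF borel borel_closed[OF closed_X_approx[of n]]]
      X_approx_subset_X_shift[of n] by (simp add: Int_absorb1)
  define C where "C l = (shift_map ^^ l) -` X_approx n \<inter> space M" for l
  have C: "range C \<subseteq> sets M"
    unfolding C_def using measurable_sets[OF measurable_funpow[OF T] Xn] by auto
  \<comment> \<open>Forward invariance makes the preimages increase; as they all have the measure of
    \<open>X_approx n\<close>, so does their union.\<close>
  have "C l \<subseteq> C (Suc l)" for l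
    unfolding C_def using shift_map_X_approx[of n] by auto
  then have "incseq C" by (rule incseq_SucI)
  then have B: "emeasure M (\<Union>l. C l) = emeasure M (X_approx n)"
    using SUP_emeasure_incseq[OF C] emeasure_funpow_vimage[OF inv Xn] by (simp add: C_def)
  \<comment> \<open>Forward invariance of \<open>X_approx n\<close> alone gives only an inclusion,
    whereas \<open>ergodic_measure\<close> asks for equality with the preimage; taking the union
    over \<open>l\<close> yields it.\<close>
  have "shift_map -` (\<Union>l. C l) \<inter> space M = (\<Union>l. C l)"
  proof (intro equalityI subsetI)
    fix x assume "x \<in> shift_map -` (\<Union>l. C l) \<inter> space M"
    then obtain l where "(shift_map ^^ Suc l) x \<in> X_approx n" "x \<in> space M"
      by (auto simp: C_def funpow_swap1)
    then show "x \<in> (\<Union>l. C l)" unfolding C_def by blast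
  next
    fix x assume "x \<in> (\<Union>l. C l)"
    then obtain l where l: "(shift_map ^^ l) x \<in> X_approx n" "x \<in> space M" by (auto simp: C_def)
    then have "(shift_map ^^ l) (shift_map x) \<in> X_approx n"
      using shift_map_X_approx[of n] by (auto simp: funpow_swap1[symmetric])
    moreover have "shift_map x \<in> space M" using l(2) T by (rule measurable_space[rotated])
    ultimately show "x \<in> shift_map -` (\<Union>l. C l) \<inter> space M" using l(2) by (auto simp: C_def)
  qed
  moreover have "(\<Union>l. C l) \<in> sets M" using C by blast
  ultimately have "emeasure M (\<Union>l. C l) = 0 \<or> emeasure M (\<Union>l. C l) = 1"
    using ergodic by (simp add: ergodic_measure_def)
  moreover have "emeasure M (\<Union>l. C l) \<noteq> 1"
  proof
    assume "emeasure M (\<Union>l. C l) = 1"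
    then have "emeasure M (X_shift - X_approx n) = 0"
      using B emeasure_compl[OF Xn] emeasure_space_1 by (simp add: space)
    moreover have "openin (top_of_set X_shift) (X_shift - X_approx n)"
      using closed_X_approx[of n] by (metis Diff_eq openin_open_Int open_Compl)
    ultimately show False
      using full X_approx_proper_subset[of n] unfolding full_support_on_def by (metis Diff_iff empty_iff less_irrefl)
  qed
  ultimately have "(\<Union>l. C l) \<in> null_sets M" using C by auto
  then show ?thesis by (rule AE_I') (auto simp: C_def)
qed

theorem corollary2:
  shows "\<not> (\<exists>M :: (nat \<Rightarrow> bool) measure.
    borel_measure_on X_shift M \<and> ergodic_measure shift_map M \<and> full_support_on X_shift M)"
proof
  assume "\<exists>M :: (nat \<Rightarrow> bool) measure.
    borel_measure_on X_shift M \<and> ergodic_measure shift_map M \<and> full_support_on X_shift M"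
  then obtain M :: "(nat \<Rightarrow> bool) measure" where borel: "borel_measure_on X_shift M"
    and ergodic: "ergodic_measure shift_map M" and full: "full_support_on X_shift M"
    by blast
  interpret prob_space M using ergodic by (simp add: ergodic_measure_def)
  have inv: "invariant_measure shift_map M" using ergodic by (simp add: ergodic_measure_def)
  then have T: "shift_map \<in> measurable M M" by (simp add: invariant_measure_def)
  have space: "space M = X_shift" using space_borel_measure_on[OF borel] .
  define E where "E = X_shift \<inter> (\<lambda>x. x 0) -` {True}"
  have "open ((\<lambda>x :: nat \<Rightarrow> bool. x 0) -` {True})"
    by (rule open_vimage[OF open_discrete continuous_on_product_coordinates])
  then have E: "E \<in> sets M" and E_open: "openin (top_of_set X_shift) E"
    unfolding E_def using sets_borel_measure_on[OF borel] by (auto simp: openin_open_Int)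
  define g :: "(nat \<Rightarrow> bool) \<Rightarrow> real" where "g = indicator E"
  have g[measurable]: "g \<in> borel_measurable M" using E by (simp add: g_def)
  note [measurable] = measurable_funpow[OF T]
  \<comment> \<open>Birkhoff averages of the indicator of the cylinder [1]. Division by zero makes
    \<open>f 0\<close> vanish, so the bound by 1 holds for every \<open>N\<close>, but the integrals
    agree with that of \<open>g\<close> only for N > 0.\<close>
  define f where "f N x = (\<Sum>i=0..<N. g ((shift_map ^^ i) x)) / real N" for N x
  have f[measurable]: "f N \<in> borel_measurable M" for N unfolding f_def by measurable
  have f_ones: "f N x = real (ones x 0 N) / real N" if "x \<in> space M" for N x
  proof -
    have "g ((shift_map ^^ i) x) = of_bool (x i)" for i
      using measurable_space[OF measurable_funpow[OF T] that, of i]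
      by (simp add: g_def E_def space funpow_shift_map indicator_def)
    then show ?thesis by (simp add: f_def ones_def del: sum_of_bool_eq)
  qed
  have avoid: "AE x in M. \<forall>n l. (shift_map ^^ l) x \<notin> X_approx n"
    using AE_orbit_avoids_X_approx[OF borel ergodic full] by (simp add: AE_all_countable)
  have conv: "(\<lambda>N. f N x) \<longlonglongrightarrow> 0"
    if "x \<in> space M" "\<forall>n l. (shift_map ^^ l) x \<notin> X_approx n" for x
    using density_ones_0[of x] that f_ones space by simp
  have lim: "AE x in M. (\<lambda>N. f N x) \<longlonglongrightarrow> 0"
    using AE_space avoid by eventually_elim (rule conv)
  have bound: "AE x in M. norm (f N x) \<le> 1" for N
  proof (rule AE_I2)
    fix x assume "x \<in> space M"
    then show "norm (f N x) \<le> 1" using ones_le_length[of x 0 N] by (auto simp: f_ones divide_le_eq_1)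
  qed
  have "(\<lambda>N. integral\<^sup>L M (f N)) \<longlonglongrightarrow> integral\<^sup>L M (\<lambda>_. 0)"
    by (rule integral_dominated_convergence[where w="\<lambda>_. 1"]) (use lim bound in auto)
  moreover have "integral\<^sup>L M (f N) = integral\<^sup>L M g" if "N > 0" for N
  proof -
    have "integral\<^sup>L M (\<lambda>x. g ((shift_map ^^ i) x)) = integral\<^sup>L M g" for i
      using integral_distr[OF measurable_funpow[OF T] g, of i] distr_funpow[OF inv] by simp
    moreover have "integrable M (\<lambda>x. g ((shift_map ^^ i) x))" for i
    proof (rule integrable_const_bound[where B=1])
      show "(\<lambda>x. g ((shift_map ^^ i) x)) \<in> borel_measurable M"
        by (rule measurable_compose[OF measurable_funpow[OF T] g])
    qed (simp add: g_def indicator_def)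
    ultimately show ?thesis using that unfolding f_def by simp
  qed
  then have "eventually (\<lambda>N. integral\<^sup>L M (f N) = integral\<^sup>L M g) sequentially"
    by (auto simp: eventually_at_top_dense)
  ultimately have "(\<lambda>N::nat. integral\<^sup>L M g) \<longlonglongrightarrow> 0"
    using tendsto_cong by force
  then have "integral\<^sup>L M g = 0" by (simp add: LIMSEQ_const_iff)
  then have "emeasure M E = 0"
    using E by (simp add: g_def emeasure_eq_measure)
  \<comment> \<open>The point 1000... shows that the cylinder \<open>E\<close> is nonempty, so full
    support forbids measure 0.\<close>
  moreover have "zeros 0 \<frown> [True] \<frown> zero_seq \<in> X_approx 0" by auto
  then have "zeros 0 \<frown> [True] \<frown> zero_seq \<in> E"
    using X_approx_subset_X_shift[of 0] unfolding E_def by (auto simp: zeros_def)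
  ultimately show False
    using full E_open unfolding full_support_on_def by force
qed

end
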